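(* Let $z_G\sim\mathcal N(\overline\mu_k,\overline\sigma_k^2)$ and $z_L\sim\mathcal N(\mu_k,\sigma_k^2)$ be the jointly Gaussian variables corresponding to the global prompt $\mathbf p_G$ (PromptFL) and the local prompt $\mathbf p_L$ (CoOp), with correlation coefficient $\rho\in[0,1]$, and let $a=\mu_k/\overline\mu_k$ and $b=\sigma_k/\overline\sigma_k$. Then the optimal mixing coefficient $\theta^\star\in[0,1]$, i.e. the one minimizing the test loss $L_{\mathcal D}\big((1-\theta)\mathbf p_G+\theta\mathbf p_L\big)=P\big((1-\theta)z_G+\theta z_L<0\big)$ over $\theta\in[0,1]$, is $$\theta^\star=\mathrm{proj}_{[0,1]}\left(\frac{a-\rho b}{(a+b^2)-\rho b(a+1)}\right).$$
   Context: Setting: in a prompt-based federated learning model with binary classification, a prompt (or combination of prompts) classifies a test image by comparing the similarity $\langle\mathbf g,\mathbf h_c\rangle$ between the image feature $\mathbf g$ and the text feature $\mathbf h_c$ of each class $c$. The similarity margin (true class minus other class) of a trained prompt on a random test sample is a Gaussian variable $z$, whose mean is determined by the prompt's components along task-relevant features and whose variance is determined by its components along task-irrelevant features. The expected test loss (error rate) is $L_{\mathcal D}=P(z<0)$; equivalently, performance is measured by the ratio of the mean to the standard deviation of $z$ (larger is better). For client $k$, the means satisfy $\mu_k,\overline\mu_k>0$ and the standard deviations satisfy $\sigma_k,\overline\sigma_k>0$. The mixed algorithm with coefficient $\theta\in[0,1]$ uses the text feature $\mathbf h_c=(1-\theta)h(\mathbf p_G,\mathbf p_c)+\theta h(\mathbf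 p_L,\mathbf p_c)$, where $h(\mathbf p,\mathbf p_c)$ is the text feature generated from the learnable prompt $\mathbf p$ and the fixed prompt $\mathbf p_c$ of class $c$; by linearity its margin is $(1-\theta)z_G+\theta z_L$. $L_{\mathcal D}((1-\theta)\mathbf p_G+\theta\mathbf p_L)$ denotes the test loss of this mixed algorithm. $\mathrm{proj}_{[0,1]}(x)=\min(1,\max(0,x))$.
   Formalization: The formal theorem adds the hypothesis (a+b²) − ρb(a+1) > 0; when this denominator is negative the stated formula is always wrong (e.g. ρ=0.9, a=10, b=2 gives θ=0, but θ=1 is optimal), and when it is zero the fraction is undefined. *)

theory Defs
  imports "HOL-Probability.Probability"
begin

(* The two classes are the booleans; \<not> c is the class other than c. *)

definition margin :: "(bool \<Rightarrow> 'v::real_inner) \<Rightarrow> 'v \<Rightarrow> bool \<Rightarrow> real" where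
  "margin H g c = g \<bullet> H c - g \<bullet> H (\<not> c)"

(* A test sample is drawn from the probability space M: its image feature is g and its
   true class is y.  A classifier is given by its text features H. *)

definition test_loss ::
  "'w measure \<Rightarrow> ('w \<Rightarrow> 'v::real_inner) \<Rightarrow> ('w \<Rightarrow> bool) \<Rightarrow> (bool \<Rightarrow> 'v) \<Rightarrow> real" where
  "test_loss M g y H = measure M {w \<in> space M. margin H (g w) (y w) < 0}"

(* h p q is the text feature generated from a learnable prompt p and a fixed class
   prompt q, and pc c is the fixed prompt of class c. *)

definition prompt_features :: "('p \<Rightarrow> 'q \<Rightarrow> 'v) \<Rightarrow> (bool \<Rightarrow> 'q) \<Rightarrow> 'p \<Rightarrow> bool \<Rightarrow> 'v" where
  "prompt_features h pc p c = h p (pc c)"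

definition mixed_features ::
  "('p \<Rightarrow> 'q \<Rightarrow> 'v::real_vector) \<Rightarrow> (bool \<Rightarrow> 'q) \<Rightarrow> 'p \<Rightarrow> 'p \<Rightarrow> real \<Rightarrow> bool \<Rightarrow> 'v" where
  "mixed_features h pc pG pL \<theta> c = (1 - \<theta>) *\<^sub>R h pG (pc c) + \<theta> *\<^sub>R h pL (pc c)"

lemma margin_mixed_features:
  "margin (mixed_features h pc pG pL \<theta>) g c =
     (1 - \<theta>) * margin (prompt_features h pc pG) g c + \<theta> * margin (prompt_features h pc pL) g c"
  by (simp add: margin_def mixed_features_def prompt_features_def inner_add_right algebra_simps)

lemma test_loss_mixed_features:
  "test_loss M g y (mixed_features h pc pG pL \<theta>) =
     measure M {w \<in> space M.
       (1 - \<theta>) * margin (prompt_features h pc pG) (g w) (y w)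
         + \<theta> * margin (prompt_features h pc pL) (g w) (y w) < 0}"
  by (simp add: test_loss_def margin_mixed_features)

(* Normal distribution with mean m and standard deviation s, where s = 0 means a point
   mass; normal_density m s is a probability density only for s > 0. *)

definition gaussian :: "'w measure \<Rightarrow> ('w \<Rightarrow> real) \<Rightarrow> real \<Rightarrow> real \<Rightarrow> bool" where
  "gaussian M X m s \<longleftrightarrow>
     (s > 0 \<and> distributed M lborel X (normal_density m s)) \<or>
     (s = 0 \<and> X \<in> borel_measurable M \<and> (AE w in M. X w = m))"

(* Degenerate combinations must be allowed: they occur when the correlation is 1. *)

definition jointly_gaussian :: "'w measure \<Rightarrow> ('w \<Rightarrow> real) \<Rightarrow> ('w \<Rightarrow> real) \<Rightarrow> bool" where
  "jointly_gaussian M X Y \<longleftrightarrow> (\<forall>c d. \<exists>m s. gaussian M (\<lambda>w. c * X w + d * Y w) m s)"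

definition covariance :: "'w measure \<Rightarrow> ('w \<Rightarrow> real) \<Rightarrow> ('w \<Rightarrow> real) \<Rightarrow> real" where
  "covariance M X Y =
     (LINT w|M. (X w - integral\<^sup>L M X) * (Y w - integral\<^sup>L M Y))"

definition correlation :: "'w measure \<Rightarrow> ('w \<Rightarrow> real) \<Rightarrow> ('w \<Rightarrow> real) \<Rightarrow> real" where
  "correlation M X Y =
     covariance M X Y / (sqrt (covariance M X X) * sqrt (covariance M Y Y))"

definition proj01 :: "real \<Rightarrow> real" where
  "proj01 x = min 1 (max 0 x)"

end

theory Submission
  imports Defs
begin

text \<open>The loss of the mixture is the standard normal distribution function at minus the ratio of
  mean to standard deviation, so minimising it means maximising that ratio.  For the correlation
  in [0, 1] the variance does not vanish on [0, 1], even in the degenerate case \<open>\<rho> = 1\<close>.  The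
  derivative of the ratio has the sign of an affine function of the mixing coefficient, which is
  decreasing since the denominator is positive; the ratio therefore increases strictly up to the
  projected zero and decreases strictly after it.\<close>

text \<open>The standard normal distribution function; the half-line is open to match the strict
  inequality in the loss.\<close>

definition std_normal_loss :: "real \<Rightarrow> real" where
  "std_normal_loss x = measure (density lborel (\<lambda>x. ennreal (std_normal_density x))) {..<x}"

text \<open>The density is positive everywhere, so \<open>{x..<y}\<close> could have measure zero
  only if it were Lebesgue null. Strictness is what later makes the minimiser unique.\<close>

lemma strict_mono_std_normal_loss: "strict_mono std_normal_loss"
proof (rule strict_monoI)
  fix x y :: real assume "x < y"
  let ?N = "density lborel (\<lambda>x. ennreal (std_normal_density x))"
  interpret N: prob_space ?N
    using prob_space_normal_density[of 1 0] by simp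
  have "emeasure ?N {x..<y} \<noteq> 0"
  proof
    assume "emeasure ?N {x..<y} = 0"
    then have "(\<integral>\<^sup>+ t. ennreal (std_normal_density t) * indicator {x..<y} t \<partial>lborel) = 0"
      by (simp add: emeasure_density)
    then have "AE t in lborel. ennreal (std_normal_density t) * indicator {x..<y} t = 0"
      by (subst (asm) nn_integral_0_iff_AE) auto
    then have "AE t in lborel. t \<notin> {x..<y}"
    proof eventually_elim
      case (elim t)
      then show ?case
        using normal_density_pos[of 1 0 t] by (auto simp: indicator_def split: if_splits)
    qed
    then have "emeasure lborel {x..<y} = 0"
      by (subst (asm) AE_iff_measurable[where N = "{x..<y}"]) auto
    with \<open>x < y\<close> show False by simp
  qed
  then have pos: "0 < measure ?N {x..<y}"
    by (simp add: N.emeasure_eq_measure zero_less_measure_iff)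
  have "{..<y} = {..<x} \<union> {x..<y}" using \<open>x < y\<close> by auto
  then have "std_normal_loss y = std_normal_loss x + measure ?N {x..<y}"
    unfolding std_normal_loss_def by (simp add: N.finite_measure_Union disjoint_iff)
  with pos show "std_normal_loss x < std_normal_loss y" by simp
qed

lemma (in prob_space) prob_normal_neg:
  assumes "s > 0" and X: "distributed M lborel X (normal_density m s)"
  shows "prob {w \<in> space M. X w < 0} = std_normal_loss (- (m / s))"
proof -
  let ?Z = "\<lambda>w. (X w - m) / s"
  have Z: "distributed M lborel ?Z std_normal_density"
    using normal_standard_normal_convert[OF \<open>s > 0\<close>] X by simp
  have "{w \<in> space M. X w < 0} = ?Z -` {..< - (m / s)} \<inter> space M"
    using \<open>s > 0\<close> by (auto simp: divide_simps)
  also have "prob \<dots> = measure (distr M lborel ?Z) {..< - (m / s)}"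
    using distributed_measurable[OF Z] by (simp add: measure_distr)
  finally show ?thesis
    by (simp add: std_normal_loss_def distributed_distr_eq_density[OF Z])
qed

lemma (in prob_space) integrable_normal:
  assumes "s > 0" and X: "distributed M lborel X (normal_density m s)"
  shows "integrable M X"
proof -
  have "integrable lborel (\<lambda>x. normal_density m s x * x)"
    using integrable_normal_moment_nz_1[OF \<open>s > 0\<close>] by simp
  then show ?thesis
    using distributed_integrable[OF X, of "\<lambda>x. x"] by simp
qed

lemma (in prob_space) covariance_normal:
  assumes "s > 0" and X: "distributed M lborel X (normal_density m s)"
  shows "covariance M X X = s\<^sup>2"
  using normal_distributed_variance[OF assms] by (simp add: covariance_def power2_eq_square)

text \<open>Applied to centred variables, this makes the cross term in the variance of a mixture
  integrable.\<close>

lemma integrable_mult_of_squares: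
  fixes f k :: "'a \<Rightarrow> real"
  assumes "integrable M (\<lambda>w. (f w)\<^sup>2)" "integrable M (\<lambda>w. (k w)\<^sup>2)"
    and [measurable]: "f \<in> borel_measurable M" "k \<in> borel_measurable M"
  shows "integrable M (\<lambda>w. f w * k w)"
proof (rule Bochner_Integration.integrable_bound)
  show "integrable M (\<lambda>w. (f w)\<^sup>2 + (k w)\<^sup>2)" using assms by simp
  have "\<bar>u * v\<bar> \<le> u\<^sup>2 + v\<^sup>2" for u v :: real
    using sum_squares_bound[of u v] sum_squares_bound[of u "- v"]
      zero_le_power2[of u] zero_le_power2[of v] by (simp add: abs_if)
  then show "AE w in M. norm (f w * k w) \<le> norm ((f w)\<^sup>2 + (k w)\<^sup>2)" by simp
qed measurable

lemma (in prob_space) covariance_linear_combination: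
  assumes X: "integrable M X" "integrable M (\<lambda>w. (X w - expectation X)\<^sup>2)"
    and Y: "integrable M Y" "integrable M (\<lambda>w. (Y w - expectation Y)\<^sup>2)"
  shows "covariance M (\<lambda>w. c * X w + d * Y w) (\<lambda>w. c * X w + d * Y w) =
    c\<^sup>2 * covariance M X X + 2 * c * d * covariance M X Y + d\<^sup>2 * covariance M Y Y"
proof -
  let ?X = "\<lambda>w. X w - expectation X" and ?Y = "\<lambda>w. Y w - expectation Y"
  have XY: "integrable M (\<lambda>w. ?X w * ?Y w)"
    using X Y by (intro integrable_mult_of_squares) auto
  have "covariance M (\<lambda>w. c * X w + d * Y w) (\<lambda>w. c * X w + d * Y w) =
    (LINT w|M. c\<^sup>2 * (?X w)\<^sup>2 + 2 * c * d * (?X w * ?Y w) + d\<^sup>2 * (?Y w)\<^sup>2)"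
    unfolding covariance_def using X(1) Y(1)
    by (intro Bochner_Integration.integral_cong) (simp_all add: power2_eq_square algebra_simps)
  also have "\<dots> = c\<^sup>2 * covariance M X X + 2 * c * d * covariance M X Y + d\<^sup>2 * covariance M Y Y"
    using X(2) Y(2) XY unfolding covariance_def power2_eq_square[symmetric]
    by simp
  finally show ?thesis .
qed

text \<open>Joint Gaussianity gives the parameters of a mixture only existentially, so they are
  recovered here as expectation and variance. Positive variance rules out the point mass.\<close>

lemma (in prob_space) prob_gaussian_neg:
  assumes "gaussian M X m s" "covariance M X X > 0"
  shows "prob {w \<in> space M. X w < 0} =
    std_normal_loss (- (expectation X / sqrt (covariance M X X)))"
proof (cases "s > 0")
  case True
  then have X: "distributed M lborel X (normal_density m s)"
    using assms(1) by (simp add: gaussian_def)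
  show ?thesis
    using prob_normal_neg[OF True X] normal_distributed_expectation[OF True X]
      covariance_normal[OF True X] True by simp
next
  case False
  then have [measurable]: "X \<in> borel_measurable M" and X: "AE w in M. X w = m"
    using assms(1) by (auto simp: gaussian_def)
  have "expectation X = (LINT w|M. m)"
    using X by (intro integral_cong_AE) auto
  then have "expectation X = m" by (simp add: prob_space)
  have "covariance M X X = (LINT w|M. 0)"
    unfolding covariance_def \<open>expectation X = m\<close> using X by (intro integral_cong_AE) auto
  with assms(2) show ?thesis by simp
qed

text \<open>With \<open>m t = (1 - t) + t * a\<close>, the numerator is \<open>m' v - m v' / 2\<close>, whose terms of second
  order in \<open>t\<close> cancel.\<close>

lemma ratio_has_derivative:
  fixes a b \<rho> t :: real
  defines "v \<equiv> \<lambda>t. (1 - t)\<^sup>2 + 2 * (1 - t) * t * \<rho> * b + t\<^sup>2 * b\<^sup>2"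
  assumes "v t > 0"
  shows "((\<lambda>t. ((1 - t) + t * a) / sqrt (v t)) has_real_derivative
    ((a - \<rho> * b) - t * ((a + b\<^sup>2) - \<rho> * b * (a + 1))) / (v t * sqrt (v t))) (at t)"
proof -
  define v' where "v' = - 2 * (1 - t) + 2 * (1 - 2 * t) * \<rho> * b + 2 * t * b\<^sup>2"
  have v: "(v has_real_derivative v') (at t)"
    unfolding v_def v'_def
    by (auto intro!: derivative_eq_intros simp: algebra_simps)
  have num: "(a - 1) * v t - ((1 - t) + t * a) * (v' / 2) =
      (a - \<rho> * b) - t * ((a + b\<^sup>2) - \<rho> * b * (a + 1))"
    unfolding v_def v'_def by (simp add: field_simps power2_eq_square)
  have sq: "sqrt (v t) * sqrt (v t) = v t" "sqrt (v t) > 0" using assms by simp_all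
  have "((\<lambda>t. ((1 - t) + t * a) / sqrt (v t)) has_real_derivative
      ((a - 1) * sqrt (v t) - ((1 - t) + t * a) * (inverse (sqrt (v t)) / 2 * v'))
        / (sqrt (v t) * sqrt (v t))) (at t)"
    using \<open>v t > 0\<close> DERIV_chain2[OF DERIV_real_sqrt[OF \<open>v t > 0\<close>] v]
    by (intro DERIV_divide) (auto intro!: derivative_eq_intros)
  \<comment> \<open>Expanding the fraction by \<open>S\<close> leaves the square root in the
    numerator only as \<open>S * S\<close>, that is \<open>v t\<close>, so the numerator becomes
    polynomial in \<open>t\<close>.\<close>
  moreover have quot: "((a - 1) * S - m * (inverse S / 2 * v')) / (S * S) =
      ((a - 1) * (S * S) - m * (v' / 2)) / (S * S * S)" if "S > 0" for S m :: real
    using that by (simp add: divide_simps)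
  ultimately show ?thesis unfolding quot[OF sq(2)] by (simp only: sq(1) num)
qed

text \<open>\<open>t\<close> and \<open>t0\<close> are compared by strict monotonicity on the
  segment between them. If the zero of the affine factor lies outside [0, 1], then \<open>t0\<close>
  is an endpoint and only one of the two cases can occur.\<close>

lemma ratio_less_at_proj:
  fixes a b \<rho> t :: real
  defines "v \<equiv> \<lambda>t. (1 - t)\<^sup>2 + 2 * (1 - t) * t * \<rho> * b + t\<^sup>2 * b\<^sup>2"
    and "D \<equiv> (a + b\<^sup>2) - \<rho> * b * (a + 1)"
  defines "r \<equiv> \<lambda>t. ((1 - t) + t * a) / sqrt (v t)"
    and "t0 \<equiv> proj01 ((a - \<rho> * b) / D)"
  assumes v: "\<And>t. t \<in> {0..1} \<Longrightarrow> v t > 0" and "D > 0" and t: "t \<in> {0..1}" "t \<noteq> t0"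
  shows "r t < r t0"
proof -
  define r' where "r' = (\<lambda>t. ((a - \<rho> * b) - t * D) / (v t * sqrt (v t)))"
  have t0: "t0 \<in> {0..1}" by (simp add: t0_def proj01_def)
  have der: "(r has_real_derivative r' t) (at t)" if "t \<in> {0..1}" for t
    using ratio_has_derivative[of t \<rho> b a] v[OF that]
    unfolding r_def r'_def v_def D_def by simp
  have cont: "continuous_on {x..y} r" if "0 \<le> x" "y \<le> 1" for x y
    using that by (intro continuous_at_imp_continuous_on ballI DERIV_isCont[OF der]) auto
  show ?thesis
  proof (cases "t < t0")
    case True
    show ?thesis
    \<comment> \<open>The derivative may vanish at \<open>t0\<close>, so its sign is required only
      strictly between the endpoints.\<close>
    proof (rule DERIV_pos_imp_increasing_open[OF True])
      fix x assume x: "t < x" "x < t0"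
      \<comment> \<open>Here \<open>x > 0\<close>, so lying below the clamped value
        \<open>t0\<close> means lying below the quotient itself.\<close>
      then have "x \<in> {0..1}" "x < (a - \<rho> * b) / D"
        using t t0 by (auto simp: t0_def proj01_def)
      then have "r' x > 0"
        using \<open>D > 0\<close> v[of x] by (auto simp: r'_def pos_less_divide_eq)
      with der[OF \<open>x \<in> {0..1}\<close>] show "\<exists>z. (r has_real_derivative z) (at x) \<and> z > 0" by blast
    qed (use cont t t0 in auto)
  next
    case False
    with t have "t0 < t" by simp
    then show ?thesis
    proof (rule DERIV_neg_imp_decreasing_open)
      fix x assume x: "t0 < x" "x < t"
      \<comment> \<open>Symmetrically, \<open>x < 1\<close>, so lying above \<open>t0\<close> means
        lying above the quotient.\<close>
      then have "x \<in> {0..1}" "(a - \<rho> * b) / D < x"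
        using t t0 by (auto simp: t0_def proj01_def)
      then have "r' x < 0"
        using \<open>D > 0\<close> v[of x] by (auto simp: r'_def pos_divide_less_eq intro!: divide_neg_pos)
      with der[OF \<open>x \<in> {0..1}\<close>] show "\<exists>z. (r has_real_derivative z) (at x) \<and> z < 0" by blast
    qed (use cont t t0 in auto)
  qed
qed

text \<open>Positivity of the denominator is a genuine restriction: for \<open>\<rho> = 1\<close> it
  equals \<open>(a - b) * (1 - b)\<close>, and if \<open>1 < b < a\<close> the ratio increases on
  [0, 1], so the optimum is 1 while the formula gives 0.\<close>

theorem theorem5p2:
  fixes M :: "'w measure"
    and g :: "'w \<Rightarrow> 'v::real_inner"
    and y :: "'w \<Rightarrow> bool"
    and h :: "'p \<Rightarrow> 'q \<Rightarrow> 'v"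
    and pc :: "bool \<Rightarrow> 'q"
    and pG pL :: 'p
    and zG zL :: "'w \<Rightarrow> real"
    and \<mu>G \<mu>L \<sigma>G \<sigma>L \<rho> a b \<theta> :: real
  assumes "prob_space M"
    and zG: "zG = (\<lambda>w. margin (prompt_features h pc pG) (g w) (y w))"
    and zL: "zL = (\<lambda>w. margin (prompt_features h pc pL) (g w) (y w))"
    and "\<mu>G > 0" "\<mu>L > 0" "\<sigma>G > 0" "\<sigma>L > 0"
    and "distributed M lborel zG (normal_density \<mu>G \<sigma>G)"
    and "distributed M lborel zL (normal_density \<mu>L \<sigma>L)"
    and "jointly_gaussian M zG zL"
    and "\<rho> = correlation M zG zL" "\<rho> \<in> {0..1}"
    and "a = \<mu>L / \<mu>G" "b = \<sigma>L / \<sigma>G"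
    and denom_pos: "(a + b\<^sup>2) - \<rho> * b * (a + 1) > 0"
  shows "is_arg_min (\<lambda>t. test_loss M g y (mixed_features h pc pG pL t)) (\<lambda>t. t \<in> {0..1}) \<theta> \<longleftrightarrow>
           \<theta> = proj01 ((a - \<rho> * b) / ((a + b\<^sup>2) - \<rho> * b * (a + 1)))"
proof -
  interpret prob_space M by fact
  note G = assms(8) and L = assms(9)
  have pos: "\<mu>G > 0" "\<mu>L > 0" "\<sigma>G > 0" "\<sigma>L > 0" "b > 0" "\<rho> \<ge> 0"
    using assms by auto
  have sigmaL: "\<sigma>L = b * \<sigma>G" using assms(14) pos by simp
  \<comment> \<open>Variance of the mixture in units of \<open>\<sigma>G\<^sup>2\<close>. The ratio
    of mean to standard deviation is then \<open>r\<close> times \<open>\<mu>G / \<sigma>G\<close>,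
    a positive factor free of \<open>t\<close>.\<close>
  define v where "v = (\<lambda>t. (1 - t)\<^sup>2 + 2 * (1 - t) * t * \<rho> * b + t\<^sup>2 * b\<^sup>2)"
  define r where "r = (\<lambda>t. ((1 - t) + t * a) / sqrt (v t))"
  define t0 where "t0 = proj01 ((a - \<rho> * b) / ((a + b\<^sup>2) - \<rho> * b * (a + 1)))"
  have v_pos: "v t > 0" if t: "t \<in> {0..1}" for t
  proof -
    \<comment> \<open>The two squares cannot vanish together, and the cross term is nonnegative
      because \<open>\<rho> \<ge> 0\<close>.\<close>
    have "(1 - t)\<^sup>2 + t\<^sup>2 * b\<^sup>2 > 0"
      using \<open>b > 0\<close> by (cases "t = 0") (auto intro!: add_nonneg_pos)
    moreover have "2 * (1 - t) * t * \<rho> * b \<ge> 0" using t pos by simp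
    ultimately show ?thesis by (simp add: v_def)
  qed
  have covGG: "covariance M zG zG = \<sigma>G\<^sup>2" and covLL: "covariance M zL zL = \<sigma>L\<^sup>2"
    using covariance_normal G L pos by blast+
  have covGL: "covariance M zG zL = \<rho> * \<sigma>G * \<sigma>L"
    using assms(11) pos by (simp add: correlation_def covGG covLL)
  have intG: "integrable M zG" and intL: "integrable M zL"
    using integrable_normal G L pos by blast+
  \<comment> \<open>The integral of a non-integrable function is 0 by convention, whereas these
    integrals are the positive variances.\<close>
  have int2: "integrable M (\<lambda>w. (zG w - expectation zG)\<^sup>2)"
      "integrable M (\<lambda>w. (zL w - expectation zL)\<^sup>2)"
    using normal_distributed_variance[OF _ G] normal_distributed_variance[OF _ L] pos
      not_integrable_integral_eq by force+
  have loss: "test_loss M g y (mixed_features h pc pG pL t) = std_normal_loss (- (\<mu>G / \<sigma>G * r t))"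
    if t: "t \<in> {0..1}" for t
  proof -
    let ?Z = "\<lambda>w. (1 - t) * zG w + t * zL w"
    have E: "expectation ?Z = \<mu>G * ((1 - t) + t * a)"
      using intG intL normal_distributed_expectation[OF _ G] normal_distributed_expectation[OF _ L]
        pos assms(13) by (simp add: field_simps)
    have V: "covariance M ?Z ?Z = \<sigma>G\<^sup>2 * v t"
      unfolding covariance_linear_combination[OF intG int2(1) intL int2(2)] covGG covLL covGL v_def
        sigmaL by (simp add: algebra_simps power2_eq_square)
    have "covariance M ?Z ?Z > 0" using V v_pos[OF t] pos by simp
    moreover obtain m s where "gaussian M ?Z m s"
      using assms(10) unfolding jointly_gaussian_def by blast
    ultimately have "prob {w \<in> space M. ?Z w < 0} = std_normal_loss (- (\<mu>G / \<sigma>G * r t))"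
      using prob_gaussian_neg[of ?Z m s] pos unfolding E V r_def by (simp add: real_sqrt_mult)
    then show ?thesis
      by (simp add: test_loss_mixed_features zG zL)
  qed
  have t0: "t0 \<in> {0..1}" by (simp add: t0_def proj01_def)
  have "test_loss M g y (mixed_features h pc pG pL t0) < test_loss M g y (mixed_features h pc pG pL t)"
    if "t \<in> {0..1}" "t \<noteq> t0" for t
  proof -
    have "r t < r t0"
      using ratio_less_at_proj[of \<rho> b a t] v_pos denom_pos that
      unfolding r_def v_def t0_def by blast
    then have "- (\<mu>G / \<sigma>G * r t0) < - (\<mu>G / \<sigma>G * r t)"
      using pos by (simp add: divide_strict_right_mono)
    then show ?thesis
      using strict_mono_std_normal_loss t0 that by (simp add: loss strict_mono_less)
  qed
  then show ?thesis
    \<comment> \<open>\<open>is_arg_min\<close> only asks that no feasible point be smaller; the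
      strict inequality against every other point gives both directions.\<close>
    unfolding t0_def[symmetric] is_arg_min_def using t0 by (metis less_asym)
qed

end
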